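(* Let $\sigma>0$ and let $X_{1,1},X_{1,2},X_{2,1},X_{2,2}$ be independent random variables, each normally distributed with mean $0$ and variance $\sigma^2$. Let $\tilde X$ be the first factor of the larger of the two products $X_{1,1}X_{1,2}$ and $X_{2,1}X_{2,2}$. Then $\tilde X$ has density $$f_{\tilde X}(x)=(2\pi\sigma^2)^{-\frac12}\exp\left(-\frac{x^2}{2\sigma^2}\right),\qquad x\in\mathbb{R},$$ i.e. $\tilde X$ is again normally distributed with mean $0$ and variance $\sigma^2$.
   Context: The first factor of the larger product is $\tilde X:=X_{J,1}$, where $J\in\{1,2\}$ is the almost surely unique index maximizing $X_{j,1}X_{j,2}$. *)

theory Defs
  imports "HOL-Probability.Probability"
begin

text \<open>
  \<open>J\<close> is an almost-sure argmax over \<open>j \<in> {1, 2}\<close> of the products \<open>X j 1 * X j 2\<close>, as a random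
  variable. On ties any choice is allowed; ties are null events for the variables considered here.
\<close>

definition larger_product_index ::
  "'a measure \<Rightarrow> (nat \<Rightarrow> nat \<Rightarrow> 'a \<Rightarrow> real) \<Rightarrow> ('a \<Rightarrow> nat) \<Rightarrow> bool" where
  "larger_product_index M X J \<longleftrightarrow>
     J \<in> measurable M (count_space {1, 2}) \<and>
     (AE \<omega> in M. is_arg_max (\<lambda>j. X j 1 \<omega> * X j 2 \<omega>) (\<lambda>j. j \<in> {1, 2}) (J \<omega>))"

definition first_factor ::
  "(nat \<Rightarrow> nat \<Rightarrow> 'a \<Rightarrow> real) \<Rightarrow> ('a \<Rightarrow> nat) \<Rightarrow> 'a \<Rightarrow> real" where
  "first_factor X J \<omega> = X (J \<omega>) 1 \<omega>"

end

theory Submission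
  imports Defs
begin

text \<open>
  Negating both second factors preserves the joint law and both first factors but reverses the
  order of the two products. So the first factor of the larger product has the same law as the
  first factor of the smaller one, and the sum of these two laws is twice the common law of the
  first factors.
\<close>

context prob_space
begin

text \<open>By independence the joint law is a product measure, and by Fubini the diagonal is null:
  its section over each value of \<open>U\<close> is a single point, which the law of
  \<open>V\<close> does not charge. Only \<open>V\<close> has to be atomless, so \<open>U\<close>
  may later be a quotient of unknown law.\<close>

lemma AE_indep_neq:
  fixes U V :: "'a \<Rightarrow> real"
  assumes "indep_var borel U borel V"
    and atomless: "\<And>x. emeasure (distr M borel V) {x} = 0"
  shows "AE \<omega> in M. U \<omega> \<noteq> V \<omega>"
proof -
  have [measurable]: "U \<in> borel_measurable M" "V \<in> borel_measurable M"
    and joint: "distr M borel U \<Otimes>\<^sub>M distr M borel V = distr M (borel \<Otimes>\<^sub>M borel) (\<lambda>\<omega>. (U \<omega>, V \<omega>))"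
    using assms(1) by (auto simp: indep_var_distribution_eq)
  interpret U: prob_space "distr M borel U" by (rule prob_space_distr) simp
  interpret V: prob_space "distr M borel V" by (rule prob_space_distr) simp
  interpret UV: pair_sigma_finite "distr M borel U" "distr M borel V" ..
  have ae: "AE y in distr M borel V. x \<noteq> y" for x
    by (rule AE_I[where N = "{x}"]) (auto simp: atomless)
  have "AE p in distr M borel U \<Otimes>\<^sub>M distr M borel V. fst p \<noteq> snd p"
  proof (rule UV.AE_pair_measure)
    have "{p \<in> space (borel \<Otimes>\<^sub>M borel). fst p \<noteq> (snd p :: real)} \<in> sets (borel \<Otimes>\<^sub>M borel)"
      by measurable
    then show "{p \<in> space (distr M borel U \<Otimes>\<^sub>M distr M borel V). fst p \<noteq> snd p}
        \<in> sets (distr M borel U \<Otimes>\<^sub>M distr M borel V)"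
      by (simp add: space_pair_measure)
  qed (use ae in auto)
  then show ?thesis
    unfolding joint by (subst (asm) AE_distr_iff) auto
qed

text \<open>Where \<open>X 1 1\<close> is nonzero, a tie forces \<open>X 1 2\<close> to equal
  \<open>X 2 1 * X 2 2 / X 1 1\<close>. This quotient is independent of the atomless
  \<open>X 1 2\<close>, so the coincidence is a null event.\<close>

lemma AE_indep_products_neq:
  fixes X :: "nat \<Rightarrow> nat \<Rightarrow> 'a \<Rightarrow> real"
  assumes indep: "indep_vars (\<lambda>_. borel) (\<lambda>(j, k). X j k) ({1, 2} \<times> {1, 2})"
    and atomless: "\<And>k x. k \<in> {1, 2} \<Longrightarrow> emeasure (distr M borel (X 1 k)) {x} = 0"
  shows "AE \<omega> in M. X 1 1 \<omega> * X 1 2 \<omega> \<noteq> X 2 1 \<omega> * X 2 2 \<omega>"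
proof -
  \<comment> \<open>\<open>?B\<close> indexes the variables in the quotient. It is disjoint from
    \<open>{(1, 2)}\<close>, so the two blocks are independent, and so are functions of
    them.\<close>
  let ?B = "{(1, 1), (2, 1), (2, 2)} :: (nat \<times> nat) set"
  have [measurable]: "X 1 1 \<in> borel_measurable M"
    using indep by (auto simp: indep_vars_def)
  have "indep_var (PiM ?B (\<lambda>_. borel)) (\<lambda>\<omega>. restrict (\<lambda>i. (case i of (j, k) \<Rightarrow> X j k) \<omega>) ?B)
      (PiM {(1, 2)} (\<lambda>_. borel)) (\<lambda>\<omega>. restrict (\<lambda>i. (case i of (j, k) \<Rightarrow> X j k) \<omega>) {(1, 2)})"
    by (rule indep_var_restrict[OF indep]) auto
  then have "indep_var borel
      ((\<lambda>f. f (2, 1) * f (2, 2) / f (1, 1)) \<circ> (\<lambda>\<omega>. restrict (\<lambda>i. (case i of (j, k) \<Rightarrow> X j k) \<omega>) ?B))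
      borel ((\<lambda>f. f (1, 2)) \<circ> (\<lambda>\<omega>. restrict (\<lambda>i. (case i of (j, k) \<Rightarrow> X j k) \<omega>) {(1, 2)}))"
    by (rule indep_var_compose) measurable
  then have "indep_var borel (\<lambda>\<omega>. X 2 1 \<omega> * X 2 2 \<omega> / X 1 1 \<omega>) borel (X 1 2)"
    by (simp add: comp_def)
  then have "AE \<omega> in M. X 2 1 \<omega> * X 2 2 \<omega> / X 1 1 \<omega> \<noteq> X 1 2 \<omega>"
    by (rule AE_indep_neq) (rule atomless, simp)
  \<comment> \<open>Division by zero yields 0, so the inequality with the quotient rules out a tie
    only where \<open>X 1 1\<close> is nonzero. Atomlessness at 0 makes this almost
    everywhere.\<close>
  moreover have "AE x in distr M borel (X 1 1). x \<noteq> 0"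
    by (rule AE_I[where N = "{0}"]) (use atomless[of 1 0] in auto)
  then have "AE \<omega> in M. X 1 1 \<omega> \<noteq> 0"
    by (subst (asm) AE_distr_iff) (auto simp del: One_nat_def)
  ultimately show ?thesis
    by eventually_elim (auto simp: field_simps)
qed

text \<open>The joint law of an independent family is the product of its marginals, hence determined
  by them. This will identify the law of the family \<open>X\<close> with that of its sign-flipped
  copy.\<close>

lemma indep_vars_joint_law_cong:
  assumes "indep_vars M' X I" "indep_vars M' Y I"
    and "\<And>i. i \<in> I \<Longrightarrow> distr M (M' i) (X i) = distr M (M' i) (Y i)"
    and "I \<noteq> {}"
  shows "distr M (PiM I M') (\<lambda>\<omega>. \<lambda>i\<in>I. X i \<omega>) = distr M (PiM I M') (\<lambda>\<omega>. \<lambda>i\<in>I. Y i \<omega>)"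
proof -
  have "distr M (PiM I M') (\<lambda>\<omega>. \<lambda>i\<in>I. X i \<omega>) = PiM I (\<lambda>i. distr M (M' i) (X i))"
    using assms(1,4) by (intro indep_vars_iff_distr_eq_PiM'[THEN iffD1]) (auto simp: indep_vars_def)
  also have "\<dots> = PiM I (\<lambda>i. distr M (M' i) (Y i))"
    by (rule PiM_cong) (auto simp: assms)
  also have "\<dots> = distr M (PiM I M') (\<lambda>\<omega>. \<lambda>i\<in>I. Y i \<omega>)"
    using assms(2,4) by (intro indep_vars_iff_distr_eq_PiM'[THEN iffD1, symmetric]) (auto simp: indep_vars_def)
  finally show ?thesis .
qed

lemma measurable_first_factor:
  assumes "\<And>j. j \<in> {1, 2} \<Longrightarrow> X j 1 \<in> borel_measurable M"
    and "J \<in> measurable M (count_space {1, 2})"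
  shows "first_factor X J \<in> borel_measurable M"
proof -
  have [measurable]: "J \<in> measurable M (count_space {1, 2})"
    "X 1 1 \<in> borel_measurable M" "X 2 1 \<in> borel_measurable M"
    using assms by auto
  have "(\<lambda>\<omega>. if J \<omega> = 1 then X 1 1 \<omega> else X 2 1 \<omega>) \<in> borel_measurable M"
    by measurable
  moreover have "first_factor X J \<omega> = (if J \<omega> = 1 then X 1 1 \<omega> else X 2 1 \<omega>)"
    if "\<omega> \<in> space M" for \<omega>
    using measurable_space[OF assms(2) that] by (auto simp: first_factor_def)
  ultimately show ?thesis
    by (simp cong: measurable_cong)
qed

text \<open>Isolates what the symmetry argument uses of the normal law: the first factors share a
  law \<open>N\<close>, the second factors are symmetric about 0, and ties are null.\<close>

lemma distr_first_factor_eq: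
  fixes X :: "nat \<Rightarrow> nat \<Rightarrow> 'a \<Rightarrow> real"
  assumes indep: "indep_vars (\<lambda>_. borel) (\<lambda>(j, k). X j k) ({1, 2} \<times> {1, 2})"
    and first: "distr M borel (X 1 1) = N" "distr M borel (X 2 1) = N"
    and sym: "\<And>j. j \<in> {1, 2} \<Longrightarrow> distr M borel (\<lambda>\<omega>. - X j 2 \<omega>) = distr M borel (X j 2)"
    and ties: "AE \<omega> in M. X 1 1 \<omega> * X 1 2 \<omega> \<noteq> X 2 1 \<omega> * X 2 2 \<omega>"
    and J: "larger_product_index M X J"
  shows "distr M borel (first_factor X J) = N"
proof (rule measure_eqI)
  show "sets (distr M borel (first_factor X J)) = sets N"
    by (simp flip: first(1))
next
  let ?I = "{1, 2} \<times> {1, 2} :: (nat \<times> nat) set"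
  let ?P = "PiM ?I (\<lambda>_. borel) :: (nat \<times> nat \<Rightarrow> real) measure"
  fix A assume "A \<in> sets (distr M borel (first_factor X J))"
  then have [measurable]: "A \<in> sets borel" by simp
  have meas: "X j k \<in> borel_measurable M" if "j \<in> {1, 2}" "k \<in> {1, 2}" for j k
    using indep that by (auto simp: indep_vars_def)
  then have [measurable]: "X 1 1 \<in> borel_measurable M" "X 1 2 \<in> borel_measurable M"
    "X 2 1 \<in> borel_measurable M" "X 2 2 \<in> borel_measurable M"
    by auto
  have [measurable]: "first_factor X J \<in> borel_measurable M"
    using J meas by (intro measurable_first_factor) (auto simp: larger_product_index_def)
  \<comment> \<open>The sign-flipped family. The flip acts on each coordinate separately, so
    independence survives; by \<open>sym\<close> the marginals survive too, and with them the joint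
    law.\<close>
  define S where "S j k = (if k = 2 then \<lambda>\<omega>. - X j k \<omega> else X j k)" for j k
  have S_simps: "S j (Suc 0) = X j (Suc 0)" "S j 2 = (\<lambda>\<omega>. - X j 2 \<omega>)" for j
    by (simp_all add: S_def)
  have "indep_vars (\<lambda>_. borel)
      (\<lambda>i \<omega>. (if snd i = 2 then - (case i of (j, k) \<Rightarrow> X j k) \<omega> else (case i of (j, k) \<Rightarrow> X j k) \<omega>)) ?I"
    by (rule indep_vars_compose2[OF indep, of "\<lambda>i x. if snd i = 2 then - x else x"]) simp
  then have "indep_vars (\<lambda>_. borel) (\<lambda>(j, k). S j k) ?I"
    by (rule indep_vars_cong[THEN iffD1, rotated -1]) (auto simp: S_def)
  then have law: "distr M ?P (\<lambda>\<omega>. \<lambda>i\<in>?I. (case i of (j, k) \<Rightarrow> X j k) \<omega>)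
      = distr M ?P (\<lambda>\<omega>. \<lambda>i\<in>?I. (case i of (j, k) \<Rightarrow> S j k) \<omega>)"
    by (intro indep_vars_joint_law_cong[OF indep]) (auto simp: S_def sym)
  \<comment> \<open>Equality of the joint laws, evaluated on the measurable set of coordinate
    vectors cut out by \<open>Q\<close> and pulled back to \<open>M\<close> along each
    family.\<close>
  have transfer: "prob {\<omega> \<in> space M. Q (X 1 1 \<omega>) (X 1 2 \<omega>) (X 2 1 \<omega>) (X 2 2 \<omega>)}
      = prob {\<omega> \<in> space M. Q (X 1 1 \<omega>) (- X 1 2 \<omega>) (X 2 1 \<omega>) (- X 2 2 \<omega>)}"
    if "{f \<in> space ?P. Q (f (1, 1)) (f (1, 2)) (f (2, 1)) (f (2, 2))} \<in> sets ?P" for Q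
  proof -
    have mX: "(\<lambda>\<omega>. \<lambda>i\<in>?I. (case i of (j, k) \<Rightarrow> X j k) \<omega>) \<in> measurable M ?P"
      by (rule measurable_restrict) (auto intro: meas)
    have mS: "(\<lambda>\<omega>. \<lambda>i\<in>?I. (case i of (j, k) \<Rightarrow> S j k) \<omega>) \<in> measurable M ?P"
      by (rule measurable_restrict) (auto simp: S_def simp del: One_nat_def)
    have "measure (distr M ?P (\<lambda>\<omega>. \<lambda>i\<in>?I. (case i of (j, k) \<Rightarrow> X j k) \<omega>))
          {f \<in> space ?P. Q (f (1, 1)) (f (1, 2)) (f (2, 1)) (f (2, 2))}
        = prob {\<omega> \<in> space M. Q (X 1 1 \<omega>) (X 1 2 \<omega>) (X 2 1 \<omega>) (X 2 2 \<omega>)}"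
      using measurable_space[OF mX]
      by (subst measure_distr[OF mX that]) (auto intro!: arg_cong[where f = prob])
    moreover have "measure (distr M ?P (\<lambda>\<omega>. \<lambda>i\<in>?I. (case i of (j, k) \<Rightarrow> S j k) \<omega>))
          {f \<in> space ?P. Q (f (1, 1)) (f (1, 2)) (f (2, 1)) (f (2, 2))}
        = prob {\<omega> \<in> space M. Q (X 1 1 \<omega>) (- X 1 2 \<omega>) (X 2 1 \<omega>) (- X 2 2 \<omega>)}"
      using measurable_space[OF mS]
      by (subst measure_distr[OF mS that]) (auto intro!: arg_cong[where f = prob] simp: S_simps)
    ultimately show ?thesis
      by (simp only: law)
  qed
  let ?p = "\<lambda>j \<omega>. X j 1 \<omega> * X j 2 \<omega>"
  \<comment> \<open>Negating \<open>b\<close> and \<open>d\<close> turns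
    \<open>a * b > c * d\<close> into \<open>a * b < c * d\<close> and leaves \<open>a\<close>
    alone.\<close>
  have flip1: "prob {\<omega> \<in> space M. X 1 1 \<omega> \<in> A \<and> ?p 1 \<omega> > ?p 2 \<omega>}
      = prob {\<omega> \<in> space M. X 1 1 \<omega> \<in> A \<and> ?p 1 \<omega> < ?p 2 \<omega>}"
    using transfer[of "\<lambda>a b c d. a \<in> A \<and> a * b > c * d"] by simp
  have flip2: "prob {\<omega> \<in> space M. X 2 1 \<omega> \<in> A \<and> ?p 1 \<omega> < ?p 2 \<omega>}
      = prob {\<omega> \<in> space M. X 2 1 \<omega> \<in> A \<and> ?p 1 \<omega> > ?p 2 \<omega>}"
    using transfer[of "\<lambda>a b c d. c \<in> A \<and> a * b < c * d"] by simp
  \<comment> \<open>Ties being null, the two strict orders of the products partition the event up to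
    a null set.\<close>
  have split: "prob {\<omega> \<in> space M. X j 1 \<omega> \<in> A}
      = prob {\<omega> \<in> space M. X j 1 \<omega> \<in> A \<and> ?p 1 \<omega> > ?p 2 \<omega>}
        + prob {\<omega> \<in> space M. X j 1 \<omega> \<in> A \<and> ?p 1 \<omega> < ?p 2 \<omega>}" if "j \<in> {1, 2}" for j
  proof -
    have [measurable]: "X j 1 \<in> borel_measurable M" using meas that by auto
    have "prob {\<omega> \<in> space M. X j 1 \<omega> \<in> A}
        = prob ({\<omega> \<in> space M. X j 1 \<omega> \<in> A \<and> ?p 1 \<omega> > ?p 2 \<omega>}
          \<union> {\<omega> \<in> space M. X j 1 \<omega> \<in> A \<and> ?p 1 \<omega> < ?p 2 \<omega>})"
    proof (rule finite_measure_eq_AE)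
      show "AE \<omega> in M. \<omega> \<in> {\<omega> \<in> space M. X j 1 \<omega> \<in> A} \<longleftrightarrow>
          \<omega> \<in> {\<omega> \<in> space M. X j 1 \<omega> \<in> A \<and> ?p 1 \<omega> > ?p 2 \<omega>}
            \<union> {\<omega> \<in> space M. X j 1 \<omega> \<in> A \<and> ?p 1 \<omega> < ?p 2 \<omega>}"
        using ties by eventually_elim auto
    qed measurable
    also have "\<dots> = prob {\<omega> \<in> space M. X j 1 \<omega> \<in> A \<and> ?p 1 \<omega> > ?p 2 \<omega>}
        + prob {\<omega> \<in> space M. X j 1 \<omega> \<in> A \<and> ?p 1 \<omega> < ?p 2 \<omega>}"
    proof (rule finite_measure_Union)
      show "{\<omega> \<in> space M. X j 1 \<omega> \<in> A \<and> ?p 1 \<omega> > ?p 2 \<omega>}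
          \<inter> {\<omega> \<in> space M. X j 1 \<omega> \<in> A \<and> ?p 1 \<omega> < ?p 2 \<omega>} = {}"
        by auto
    qed measurable
    finally show ?thesis .
  qed
  have N: "prob {\<omega> \<in> space M. X j 1 \<omega> \<in> A} = measure N A" if "j \<in> {1, 2}" for j
  proof -
    have "distr M borel (X j 1) = N" "X j 1 \<in> borel_measurable M"
      using that first meas by auto
    then show ?thesis
      by (auto simp: measure_distr vimage_def Int_def conj_commute)
  qed
  \<comment> \<open>Away from ties the argmax is unique, so \<open>J\<close> is 1 or 2 according to
    the strict order of the products. At a tie \<open>J\<close> may be either index.\<close>
  have "AE \<omega> in M. (first_factor X J \<omega> \<in> A) \<longleftrightarrow>
      (X 1 1 \<omega> \<in> A \<and> ?p 1 \<omega> > ?p 2 \<omega>) \<or> (X 2 1 \<omega> \<in> A \<and> ?p 1 \<omega> < ?p 2 \<omega>)"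
    using J[unfolded larger_product_index_def, THEN conjunct2] ties
    by eventually_elim (auto simp: is_arg_max_def first_factor_def)
  then have "prob {\<omega> \<in> space M. first_factor X J \<omega> \<in> A}
      = prob ({\<omega> \<in> space M. X 1 1 \<omega> \<in> A \<and> ?p 1 \<omega> > ?p 2 \<omega>}
        \<union> {\<omega> \<in> space M. X 2 1 \<omega> \<in> A \<and> ?p 1 \<omega> < ?p 2 \<omega>})"
    by (intro finite_measure_eq_AE) (auto simp del: One_nat_def)
  also have "\<dots> = prob {\<omega> \<in> space M. X 1 1 \<omega> \<in> A \<and> ?p 1 \<omega> > ?p 2 \<omega>}
      + prob {\<omega> \<in> space M. X 2 1 \<omega> \<in> A \<and> ?p 1 \<omega> < ?p 2 \<omega>}"
    by (rule finite_measure_Union) (auto simp del: One_nat_def)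
  \<comment> \<open>By \<open>split\<close> and \<open>N\<close>, each first factor lies in
    \<open>A\<close> with probability \<open>measure N A\<close>, and the flips cut this into two
    equal parts. Each summand is therefore half of \<open>measure N A\<close>.\<close>
  also have "\<dots> = measure N A"
    using split[of 1] split[of 2] N[of 1] N[of 2] flip1 flip2 by simp
  finally have "measure (distr M borel (first_factor X J)) A = measure N A"
    by (simp add: measure_distr vimage_def Int_def conj_commute)
  moreover have "finite_measure N"
    unfolding first(1)[symmetric] by (rule finite_measure_distr) measurable
  moreover have "finite_measure (distr M borel (first_factor X J))"
    by (rule finite_measure_distr) simp
  ultimately show "emeasure (distr M borel (first_factor X J)) A = emeasure N A"
    by (simp add: finite_measure.emeasure_eq_measure)
qed

end

lemma normal_density_zero_mean_powr:
  assumes "\<sigma> > 0"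
  shows "normal_density 0 \<sigma> x = (2 * pi * \<sigma>\<^sup>2) powr (-1/2) * exp (- x\<^sup>2 / (2 * \<sigma>\<^sup>2))"
proof -
  have "(2 * pi * \<sigma>\<^sup>2) powr (-1/2) = 1 / sqrt (2 * pi * \<sigma>\<^sup>2)"
    using powr_minus[of "2 * pi * \<sigma>\<^sup>2" "1/2"] assms
    by (simp add: powr_half_sqrt inverse_eq_divide)
  then show ?thesis by (simp add: normal_density_def)
qed

theorem mainTheorem10:
  fixes M :: "'a measure"
    and X :: "nat \<Rightarrow> nat \<Rightarrow> 'a \<Rightarrow> real"
    and J :: "'a \<Rightarrow> nat"
    and \<sigma> :: real
  assumes "prob_space M"
    and "\<sigma> > 0"
    and "prob_space.indep_vars M (\<lambda>_. borel) (\<lambda>(j, k). X j k) ({1, 2} \<times> {1, 2})"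
    and "\<And>j k. j \<in> {1, 2} \<Longrightarrow> k \<in> {1, 2} \<Longrightarrow>
           distributed M lborel (X j k) (normal_density 0 \<sigma>)"
    and "larger_product_index M X J"
  shows "(AE \<omega> in M. \<exists>!j. is_arg_max (\<lambda>j. X j 1 \<omega> * X j 2 \<omega>) (\<lambda>j. j \<in> {1, 2}) j)
    \<and> distributed M lborel (first_factor X J)
        (\<lambda>x. ennreal ((2 * pi * \<sigma>\<^sup>2) powr (-1/2) * exp (- x\<^sup>2 / (2 * \<sigma>\<^sup>2))))
    \<and> distributed M lborel (first_factor X J) (normal_density 0 \<sigma>)"
proof -
  interpret prob_space M by fact
  let ?N = "density lborel (\<lambda>x. ennreal (normal_density 0 \<sigma> x))"
  \<comment> \<open>\<open>distributed\<close> refers to \<open>lborel\<close>, independence to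
    \<open>borel\<close>. The two have the same measurable sets, which is all that
    \<open>distr\<close> takes from its target.\<close>
  have distr_borel: "distr M borel Y = distr M lborel Y" for Y :: "'a \<Rightarrow> real"
    by (rule distr_cong) auto
  have law: "distr M borel (X j k) = ?N" if "j \<in> {1, 2}" "k \<in> {1, 2}" for j k
    using distributed_distr_eq_density[OF assms(4)[OF that]] by (simp add: distr_borel)
  have sym: "distr M borel (\<lambda>\<omega>. - X j 2 \<omega>) = distr M borel (X j 2)" if "j \<in> {1, 2}" for j
  proof -
    \<comment> \<open>Negation as the affine map with intercept 0 and slope -1: the mean stays 0 and
      the deviation becomes |-1| * \<sigma> = \<sigma>.\<close>
    have "distributed M lborel (\<lambda>\<omega>. 0 + - 1 * X j 2 \<omega>) (normal_density (0 + - 1 * 0) (\<bar>- 1\<bar> * \<sigma>))"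
      by (rule normal_density_affine) (use assms that in auto)
    then show ?thesis
      using law[of j 2] that by (simp add: distributed_def distr_borel)
  qed
  \<comment> \<open>Singletons are Lebesgue-null, so a law with a Lebesgue density has no
    atoms.\<close>
  have atomless: "emeasure ?N {x} = 0" for x
    by (simp add: emeasure_density nn_integral_indicator_singleton')
  have ties: "AE \<omega> in M. X 1 1 \<omega> * X 1 2 \<omega> \<noteq> X 2 1 \<omega> * X 2 2 \<omega>"
    by (rule AE_indep_products_neq[OF assms(3)]) (simp add: law atomless)
  then have "AE \<omega> in M. \<exists>!j. is_arg_max (\<lambda>j. X j 1 \<omega> * X j 2 \<omega>) (\<lambda>j. j \<in> {1, 2}) j"
  proof eventually_elim
    case (elim \<omega>)
    then consider "X 1 1 \<omega> * X 1 2 \<omega> < X 2 1 \<omega> * X 2 2 \<omega>" | "X 1 1 \<omega> * X 1 2 \<omega> > X 2 1 \<omega> * X 2 2 \<omega>"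
      by linarith
    then show ?case
    proof cases
      case 1
      then show ?thesis by (intro ex1I[of _ 2]) (auto simp: is_arg_max_def)
    next
      case 2
      then show ?thesis by (intro ex1I[of _ 1]) (auto simp: is_arg_max_def)
    qed
  qed
  moreover have "distr M borel (first_factor X J) = ?N"
    by (rule distr_first_factor_eq[OF assms(3) _ _ sym ties assms(5)]) (auto simp: law)
  moreover have "first_factor X J \<in> borel_measurable M"
    using assms(4,5)
    by (intro measurable_first_factor) (auto simp: larger_product_index_def distributed_def)
  \<comment> \<open>Folding the explicit formula back into \<open>normal_density\<close> makes the
    two density claims coincide.\<close>
  ultimately show ?thesis
    unfolding normal_density_zero_mean_powr[OF assms(2), symmetric]
    by (simp add: distributed_def distr_borel)
qed

end
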